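(* Let $L$ be a lowly finite poset with a lowest element. Then the set $\{u_L(a) \mid a \in L\}$ is a complete set of orthogonal idempotents in $\mathrm{M\ddot{o}b}(L)$; that is, it is a $\mathbb{Z}$-basis of $\mathrm{M\ddot{o}b}(L)$, $u_L(a) \cdot u_L(a) = u_L(a)$ for every $a \in L$, and $u_L(a) \cdot u_L(b) = 0$ for all $a,b \in L$ with $a \neq b$.
   Context: A poset $L$ is lowly finite if $\{b \in L \mid b \preceq a\}$ is finite for every $a \in L$. $\mu_L$ is the Möbius function of $L$: $\mu_L(a,a)=1$ and $\mu_L(a,b) = -\sum_{a \preceq c \prec b} \mu_L(a,c)$ for $a \prec b$. $\mathbb{Z}L$ is the free $\mathbb{Z}$-module with basis $L$, and for $a \in L$, $u_L(a) := \sum_{c \in L,\, c \preceq a} \mu_L(c,a)\, c \in \mathbb{Z}L$. The Möbius algebra $\mathrm{M\ddot{o}b}(L)$ is the module $\mathbb{Z}L$ with the bilinear multiplication defined on basis elements $a,b \in L$ by $a \cdot b := \sum_{c \in L,\, c \preceq a,\, c \preceq b} u_L(c)$ (a multiplicative unit is not required to exist). *)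

theory Defs
  imports Complex_Main "HOL-Library.Poly_Mapping"
begin

class lowly_finite_order = order +
  assumes finite_below: "finite {b. b \<le> a}"

text \<open>The last branch is the usual convention for pairs outside the order relation; these pairs
  do not occur below.\<close>

function mobius :: "'a::lowly_finite_order \<Rightarrow> 'a \<Rightarrow> int" where
  "mobius a b =
     (if a = b then 1
      else if a < b then - (\<Sum>c\<in>{c. a \<le> c \<and> c < b}. mobius a c)
      else 0)"
  by auto
termination
proof (relation "measure (\<lambda>(a, b). card {c. c \<le> b})")
  fix a b c :: 'a
  assume "c \<in> {c. a \<le> c \<and> c < b}"
  then have "c < b"
    by simp
  then have "b \<in> {d. d \<le> b} - {d. d \<le> c}" "{d. d \<le> c} \<subseteq> {d. d \<le> b}"
    by (auto simp: less_le_not_le)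
  then have "{d. d \<le> c} \<subset> {d. d \<le> b}"
    by blast
  then show "((a, c), (a, b)) \<in> measure (\<lambda>(a, b). card {c. c \<le> b})"
    by (simp add: psubset_card_mono finite_below)
qed simp

declare mobius.simps [simp del]

text \<open>The free module on \<open>L\<close> is the type \<open>'a \<Rightarrow>\<^sub>0 int\<close> of finitely supported functions,
  with basis elements \<^const>\<open>frag_of\<close> and scalar multiplication \<^const>\<open>frag_cmul\<close>.\<close>

global_interpretation frag: module frag_cmul
  by unfold_locales (simp_all add: frag_cmul_distrib frag_cmul_distrib2)

definition mobius_idem :: "'a::lowly_finite_order \<Rightarrow> ('a \<Rightarrow>\<^sub>0 int)" where
  "mobius_idem a = (\<Sum>c\<in>{c. c \<le> a}. frag_cmul (mobius c a) (frag_of c))"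

text \<open>The bilinear extension of the product of basis elements; see the four lemmas that follow.\<close>

definition mobius_mult ::
    "('a::lowly_finite_order \<Rightarrow>\<^sub>0 int) \<Rightarrow> ('a \<Rightarrow>\<^sub>0 int) \<Rightarrow> ('a \<Rightarrow>\<^sub>0 int)" where
  "mobius_mult x y =
     frag_extend (\<lambda>a. frag_extend (\<lambda>b. \<Sum>c\<in>{c. c \<le> a \<and> c \<le> b}. mobius_idem c) y) x"

lemma mobius_mult_frag_of:
  "mobius_mult (frag_of a) (frag_of b) = (\<Sum>c\<in>{c. c \<le> a \<and> c \<le> b}. mobius_idem c)"
  by (simp add: mobius_mult_def)

lemma mobius_mult_commute: "mobius_mult x y = mobius_mult y x"
  unfolding mobius_mult_def frag_extend_def frag_cmul_sum
  by (subst sum.swap) (simp add: mult.commute conj_commute)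

lemma mobius_mult_add_left: "mobius_mult (x + y) z = mobius_mult x z + mobius_mult y z"
  by (simp add: mobius_mult_def frag_extend_add)

lemma mobius_mult_cmul_left: "mobius_mult (frag_cmul k x) y = frag_cmul k (mobius_mult x y)"
  by (simp add: mobius_mult_def frag_extend_cmul)

end

theory Submission
  imports Defs
begin

text \<open>Moebius inversion gives \<open>a = (\<Sum>c \<le> a. u c)\<close> for every basis element \<open>a\<close>, where \<open>u\<close> is
  \<^const>\<open>mobius_idem\<close>, so the elements \<open>u c\<close> span. The product is made such that this expansion
  turns it into intersection of principal ideals:
  \<open>a \<cdot> b = (\<Sum>c \<le> a, c \<le> b. u c)\<close> is what orthogonality and idempotency of the \<open>u c\<close> force.
  Conversely, that formula implies orthogonality, because a family indexed by \<open>L\<close> is determined by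
  its sums over principal ideals (\<open>eq_if_sums_below_eq\<close>): comparing such sums in the first factor
  shows that \<open>u a \<cdot> b\<close> is \<open>u a\<close> if \<open>a \<le> b\<close> and \<open>0\<close> otherwise, and comparing them
  in the second factor yields the products \<open>u a \<cdot> u b\<close>. Nonzero orthogonal idempotents
  in a torsion-free module are linearly independent, since multiplication by \<open>u a\<close> isolates the
  coefficient of \<open>u a\<close>.\<close>

lemma wf_less_lowly_finite: "wf {(x, y :: 'a::lowly_finite_order). x < y}"
proof (rule wf_subset[OF wf_measure[of "\<lambda>a. card {c. c \<le> a}"]])
  have "card {c. c \<le> x} < card {c. c \<le> y}" if "x < y" for x y :: 'a
  proof (rule psubset_card_mono[OF finite_below])
    have "y \<in> {c. c \<le> y} - {c. c \<le> x}" "{c. c \<le> x} \<subseteq> {c. c \<le> y}"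
      using that by (auto simp: less_le_not_le intro: order.trans)
    then show "{c. c \<le> x} \<subset> {c. c \<le> y}"
      by blast
  qed
  then show "{(x, y :: 'a). x < y} \<subseteq> measure (\<lambda>a. card {c. c \<le> a})"
    by auto
qed

lemma sum_below_split:
  fixes f :: "'a::lowly_finite_order \<Rightarrow> 'b::comm_monoid_add"
  shows "(\<Sum>c\<in>{c. c \<le> a}. f c) = f a + (\<Sum>c\<in>{c. c < a}. f c)"
proof -
  have "{c. c \<le> a} = insert a {c. c < a}"
    by auto
  moreover have "finite {c. c < a}"
    by (rule finite_subset[OF _ finite_below[of a]]) auto
  ultimately show ?thesis
    by simp
qed

text \<open>This is uniqueness in Moebius inversion. Well-founded induction cancels all terms strictly
  below \<open>a\<close>, so that no formula for the inverse is needed.\<close>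

lemma eq_if_sums_below_eq:
  fixes f g :: "'a::lowly_finite_order \<Rightarrow> 'b::ab_group_add"
  assumes "\<And>a. (\<Sum>c\<in>{c. c \<le> a}. f c) = (\<Sum>c\<in>{c. c \<le> a}. g c)"
  shows "f a = g a"
proof (induction a rule: wf_induct_rule[OF wf_less_lowly_finite])
  case (1 a)
  then have "(\<Sum>c\<in>{c. c < a}. f c) = (\<Sum>c\<in>{c. c < a}. g c)"
    by (intro sum.cong) auto
  then show ?case
    using assms[of a] by (simp add: sum_below_split)
qed

lemma sum_mobius_interval:
  fixes d a :: "'a::lowly_finite_order"
  assumes "d \<le> a"
  shows "(\<Sum>c\<in>{c. d \<le> c \<and> c \<le> a}. mobius d c) = (if d = a then 1 else 0)"
proof (cases "d = a")
  case True
  then have "{c. d \<le> c \<and> c \<le> a} = {a}"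
    by auto
  with True show ?thesis
    by (simp add: mobius.simps)
next
  case False
  with assms have "d < a" and eq: "{c. d \<le> c \<and> c \<le> a} = insert a {c. d \<le> c \<and> c < a}"
    by auto
  have "finite {c. d \<le> c \<and> c < a}"
    by (rule finite_subset[OF _ finite_below[of a]]) auto
  with \<open>d < a\<close> show ?thesis
    unfolding eq by (simp add: mobius.simps[of d a])
qed

text \<open>After exchanging the sums, the coefficient of \<open>d\<close> is a sum of \<^const>\<open>mobius\<close> over the interval
  from \<open>d\<close> to \<open>a\<close> in its second argument, which is what the recursion for \<^const>\<open>mobius\<close> evaluates.\<close>

lemma sum_mobius_idem_below:
  fixes a :: "'a::lowly_finite_order"
  shows "(\<Sum>c\<in>{c. c \<le> a}. mobius_idem c) = frag_of a"
proof -
  have "(\<Sum>c\<in>{c. c \<le> a}. mobius_idem c) =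
      (\<Sum>c\<in>{c. c \<le> a}. \<Sum>d\<in>{d. d \<in> {d. d \<le> a} \<and> d \<le> c}. frag_cmul (mobius d c) (frag_of d))"
    unfolding mobius_idem_def by (intro sum.cong) (auto intro: order.trans)
  also have "\<dots> =
      (\<Sum>d\<in>{d. d \<le> a}. \<Sum>c\<in>{c. c \<in> {c. c \<le> a} \<and> d \<le> c}. frag_cmul (mobius d c) (frag_of d))"
    by (rule sum.swap_restrict) (simp_all add: finite_below)
  also have "\<dots> =
      (\<Sum>d\<in>{d. d \<le> a}. frag_cmul (\<Sum>c\<in>{c. d \<le> c \<and> c \<le> a}. mobius d c) (frag_of d))"
    by (simp add: frag.scale_sum_left conj_commute)
  also have "\<dots> = (\<Sum>d\<in>{d. d \<le> a}. if d = a then frag_of d else 0)"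
    by (intro sum.cong) (auto simp: sum_mobius_interval)
  also have "\<dots> = frag_of a"
    by (simp add: finite_below)
  finally show ?thesis .
qed

lemma mobius_mult_zero_left: "mobius_mult 0 y = 0"
  by (simp add: mobius_mult_def)

lemma mobius_mult_sum_left: "mobius_mult (\<Sum>i\<in>I. f i) y = (\<Sum>i\<in>I. mobius_mult (f i) y)"
  by (induction I rule: infinite_finite_induct)
     (simp_all add: mobius_mult_zero_left mobius_mult_add_left)

lemma mobius_mult_sum_right: "mobius_mult x (\<Sum>i\<in>I. f i) = (\<Sum>i\<in>I. mobius_mult x (f i))"
  using mobius_mult_sum_left[of f I x] by (simp add: mobius_mult_commute)

text \<open>By expansion in the idempotents, the sum of the left-hand sides over all \<open>c \<le> a\<close> is the product
  of the basis elements \<open>a\<close> and \<open>b\<close>, and the definition of that product is the sum of the right-hand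
  sides. So equality holds for each summand. \<open>mobius_mult_idem_idem\<close> repeats this in the second
  factor.\<close>

lemma mobius_mult_idem_frag_of:
  fixes a b :: "'a::lowly_finite_order"
  shows "mobius_mult (mobius_idem a) (frag_of b) = (if a \<le> b then mobius_idem a else 0)"
proof (rule eq_if_sums_below_eq[of "\<lambda>a. mobius_mult (mobius_idem a) (frag_of b)"])
  fix a :: 'a
  have "(\<Sum>c\<in>{c. c \<le> a}. mobius_mult (mobius_idem c) (frag_of b)) =
      mobius_mult (frag_of a) (frag_of b)"
    by (simp add: mobius_mult_sum_left[symmetric] sum_mobius_idem_below)
  also have "\<dots> = (\<Sum>c\<in>{c. c \<le> a}. if c \<le> b then mobius_idem c else 0)"
    by (simp add: mobius_mult_frag_of sum.inter_filter[symmetric] finite_below)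
  finally show "(\<Sum>c\<in>{c. c \<le> a}. mobius_mult (mobius_idem c) (frag_of b)) =
      (\<Sum>c\<in>{c. c \<le> a}. if c \<le> b then mobius_idem c else 0)" .
qed

lemma mobius_mult_idem_idem:
  fixes a b :: "'a::lowly_finite_order"
  shows "mobius_mult (mobius_idem a) (mobius_idem b) = (if b = a then mobius_idem a else 0)"
proof (rule eq_if_sums_below_eq[of "\<lambda>b. mobius_mult (mobius_idem a) (mobius_idem b)"])
  fix b :: 'a
  show "(\<Sum>c\<in>{c. c \<le> b}. mobius_mult (mobius_idem a) (mobius_idem c)) =
      (\<Sum>c\<in>{c. c \<le> b}. if c = a then mobius_idem a else 0)"
    by (simp add: mobius_mult_sum_right[symmetric] sum_mobius_idem_below
        mobius_mult_idem_frag_of finite_below)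
qed

lemma lookup_mobius_idem_self: "Poly_Mapping.lookup (mobius_idem a) a = 1"
proof -
  have "Poly_Mapping.lookup (mobius_idem a) a = (\<Sum>c\<in>{c. c \<le> a}. if c = a then 1 else 0)"
    unfolding mobius_idem_def lookup_sum
    by (intro sum.cong) (auto simp: lookup_single mobius.simps when_def)
  then show ?thesis
    by (simp add: finite_below)
qed

text \<open>Multiplying a vanishing linear combination by one of the idempotents leaves a multiple of
  that idempotent alone, and \<open>\<int>L\<close> is torsion-free.\<close>

lemma independent_mobius_idem:
  "frag.independent (range (mobius_idem :: 'a::lowly_finite_order \<Rightarrow> _))"
  unfolding frag.dependent_explicit
proof safe
  fix T and r :: "('a \<Rightarrow>\<^sub>0 int) \<Rightarrow> int" and v :: "'a \<Rightarrow>\<^sub>0 int"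
  assume T: "finite T" "T \<subseteq> range mobius_idem" and zero: "(\<Sum>w\<in>T. frag_cmul (r w) w) = 0"
    and "v \<in> T" "r v \<noteq> 0"
  then obtain a where v: "v = mobius_idem a"
    by auto
  have orth: "mobius_mult w v = (if w = v then v else 0)" if "w \<in> T" for w
  proof -
    obtain b where "w = mobius_idem b"
      using \<open>w \<in> T\<close> T by auto
    then show ?thesis
      by (cases "w = v") (auto simp: v mobius_mult_idem_idem)
  qed
  have "0 = mobius_mult (\<Sum>w\<in>T. frag_cmul (r w) w) v"
    by (simp add: zero mobius_mult_zero_left)
  also have "\<dots> = (\<Sum>w\<in>T. if w = v then frag_cmul (r w) v else 0)"
    unfolding mobius_mult_sum_left mobius_mult_cmul_left
    by (intro sum.cong) (auto simp: orth)
  also have "\<dots> = frag_cmul (r v) v"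
    using T \<open>v \<in> T\<close> by simp
  finally have "frag_cmul (r v) v = 0"
    by simp
  moreover have "v \<noteq> 0"
    using lookup_mobius_idem_self[of a] by (auto simp: v)
  ultimately show False
    using \<open>r v \<noteq> 0\<close> by simp
qed

lemma span_mobius_idem:
  "frag.span (range (mobius_idem :: 'a::lowly_finite_order \<Rightarrow> _)) = UNIV"
proof -
  have basis: "frag_of a \<in> frag.span (range mobius_idem)" for a :: 'a
    unfolding sum_mobius_idem_below[of a, symmetric]
    by (intro frag.span_sum frag.span_base) auto
  have "x \<in> frag.span (range mobius_idem)" for x :: "'a \<Rightarrow>\<^sub>0 int"
  proof -
    have "frag_extend frag_of x \<in> frag.span (range mobius_idem)"
      unfolding frag_extend_def by (intro frag.span_sum frag.span_scale basis)
    then show ?thesis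
      by (simp flip: frag_expansion)
  qed
  then show ?thesis
    by auto
qed

theorem corollary2p21:
  assumes "\<exists>m::'a::lowly_finite_order. \<forall>x. m \<le> x"
  shows "frag.independent (range (mobius_idem :: 'a \<Rightarrow> ('a \<Rightarrow>\<^sub>0 int)))
    \<and> frag.span (range (mobius_idem :: 'a \<Rightarrow> ('a \<Rightarrow>\<^sub>0 int))) = UNIV
    \<and> (\<forall>a::'a. mobius_mult (mobius_idem a) (mobius_idem a) = mobius_idem a)
    \<and> (\<forall>a b::'a. a \<noteq> b \<longrightarrow> mobius_mult (mobius_idem a) (mobius_idem b) = 0)"
  by (auto simp: independent_mobius_idem span_mobius_idem mobius_mult_idem_idem)

end
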